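(* Let $A\in\mathbb{R}^{n\times n}$ be symmetric positive definite with smallest eigenvalue $\lambda_1$, let $\mathcal K\subset\mathbb{R}^n$ be a subspace, and let $u_i^{(\ell)}\in\mathbb{R}^n$, $u_i^{(\ell)}\ne0$, be a given eigenvector approximation. Let $u$, with $\|u\|_A=1$ and $Au=\lambda u$, be an exact eigenvector of $A$ closest to $u_i^{(\ell)}$ (i.e. minimizing $\|u-E_m^{(i,\ell)}u\|_A$ among all eigenvectors of $A$ of unit $A$-norm), and put $\mu=1/\lambda$. Let $u_i^{(\ell+1)}$ be the output of one step of the inverse power method for one eigenvector on the subspace $\mathcal K^{(\ell+1)}:=\mathcal K+\mathrm{span}\{u_i^{(\ell)}\}$ (described in the context), let $m:=\dim\mathcal K^{(\ell+1)}\ge2$, let $\lambda_1^{(\ell+1)}\le\cdots\le\lambda_m^{(\ell+1)}$ be the Ritz values on $\mathcal K^{(\ell+1)}$, the selected one having index $i$, and put $\mu_j^{(\ell+1)}=1/\lambda_j^{(\ell+1)}$, $j=1,\dots,m$. Define $$\delta_i^{(\ell+1)}:=\min_{j\ne i}|\mu_j^{(\ell+1)}-\mu|,$$ assumed positive, and $$\theta_{\mathcal K^{(\ell+1)}}:=\sqrt{1+\frac{\mu_1^{(\ell+1)}\,\eta_{\mathcal K^{(\ell+1)}}^2}{\big(\delta_i^{(\ell+1)}\big)^2}},\qquad \eta_{\mathcal K^{(\ell+1)},i}:=\Big(1+\frac{\mu_1^{(\ell+1)}}{\delta_i^{(\ell+1)}}\Big)\eta_{\mathcal K^{(\ell+1)}}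 .$$ Then $$\|u-E_m^{(i,\ell+1)}u\|_A\le\theta_{\mathcal K^{(\ell+1)}}\sqrt{\frac{\lambda\,\lambda_i^{(\ell+1)}}{\lambda_1}}\;\eta_{\mathcal K^{(\ell+1)},i}\,\|u-E_m^{(i,\ell)}u\|_A .$$
   Context: For $x,y\in\mathbb{R}^n$: $(x,y)=x^Ty$, $(x,y)_A=x^TAy$, $\|x\|_2=\sqrt{(x,x)}$, $\|x\|_A=\sqrt{(x,x)_A}$. For a subspace $\mathcal W\subset\mathbb{R}^n$, $\mathcal P_{\mathcal W}:\mathbb{R}^n\to\mathcal W$ is the $A$-orthogonal projection, $(\mathcal P_{\mathcal W}x,y)_A=(x,y)_A$ for all $x\in\mathbb{R}^n$, $y\in\mathcal W$, and $$\eta_{\mathcal W}:=\sup_{\|g\|_2=1}\|(I-\mathcal P_{\mathcal W})A^{-1}g\|_A .$$ One step of the inverse power method on a subspace for one eigenvector: given $u_i^{(\ell)}$, (1) form $\mathcal K^{(\ell+1)}=\mathcal K+\mathrm{span}\{u_i^{(\ell)}\}$ and solve the eigenvalue problem of finding $\widetilde u\in\mathcal K^{(\ell+1)}$, $\widetilde\lambda\in\mathbb{R}$ with $\|\widetilde u\|_A=1$ and $(A\widetilde u,v)=\widetilde\lambda(\widetilde u,v)$ for all $v\in\mathcal K^{(\ell+1)}$; its solutions are listed with $\lambda_1^{(\ell+1)}\le\cdots\le\lambda_m^{(\ell+1)}$ (with multiplicity) and with $A$-orthonormal eigenvectors; among these eigenvectors select the one with the biggest orthogonal projection (in the inner product $(\cdot,\cdot)_A$)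 in the direction of $u_i^{(\ell)}$; denote it $\widetilde u_i^{(\ell+1)}$ and its eigenvalue $\lambda_i^{(\ell+1)}$, where $i$ is its index in the list; (2) solve the linear equation $Au_i^{(\ell+1)}=\lambda_i^{(\ell+1)}\widetilde u_i^{(\ell+1)}$. The output is $u_i^{(\ell+1)}$. $E_m^{(i,\ell)}$ and $E_m^{(i,\ell+1)}$ are the $A$-orthogonal projections of $\mathbb{R}^n$ onto $\mathrm{span}\{u_i^{(\ell)}\}$ and $\mathrm{span}\{u_i^{(\ell+1)}\}$ respectively, e.g. $(E_m^{(i,\ell)}w,u_i^{(\ell)})_A=(w,u_i^{(\ell)})_A$ for all $w\in\mathbb{R}^n$. *)

theory Defs
  imports "HOL-Analysis.Analysis" "HOL-Library.Set_Algebras"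
begin

definition sym_pos_def :: "real^'n^'n \<Rightarrow> bool" where
  "sym_pos_def A \<longleftrightarrow> transpose A = A \<and> (\<forall>x. x \<noteq> 0 \<longrightarrow> 0 < x \<bullet> (A *v x))"

definition A_inner :: "real^'n^'n \<Rightarrow> real^'n \<Rightarrow> real^'n \<Rightarrow> real" where
  "A_inner A x y = x \<bullet> (A *v y)"

definition A_norm :: "real^'n^'n \<Rightarrow> real^'n \<Rightarrow> real" where
  "A_norm A x = sqrt (A_inner A x x)"

definition eigenpair :: "real^'n^'n \<Rightarrow> real \<Rightarrow> real^'n \<Rightarrow> bool" where
  "eigenpair A l v \<longleftrightarrow> v \<noteq> 0 \<and> A *v v = l *\<^sub>R v"

definition smallest_eigenvalue :: "real^'n^'n \<Rightarrow> real \<Rightarrow> bool" where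
  "smallest_eigenvalue A l \<longleftrightarrow>
     (\<exists>v. eigenpair A l v) \<and> (\<forall>l' v. eigenpair A l' v \<longrightarrow> l \<le> l')"

text \<open>The description is proper whenever \<open>A\<close> is symmetric positive definite and
  \<open>W\<close> is a subspace; outside this case the value is unspecified.\<close>

definition A_proj :: "real^'n^'n \<Rightarrow> (real^'n) set \<Rightarrow> real^'n \<Rightarrow> real^'n" where
  "A_proj A W x = (THE p. p \<in> W \<and> (\<forall>y\<in>W. A_inner A p y = A_inner A x y))"

definition eta :: "real^'n^'n \<Rightarrow> (real^'n) set \<Rightarrow> real" where
  "eta A W = (SUP g\<in>{g. norm g = 1}.
     A_norm A (matrix_inv A *v g - A_proj A W (matrix_inv A *v g)))"

text \<open>The eigenvalue problem on the subspace \<open>W\<close>, and the full list of its solutions,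
  indexed by \<open>1, \<dots>, dim W\<close>. Since the \<open>dim W\<close> listed vectors are \<open>A\<close>-orthonormal, they form
  a basis of \<open>W\<close>, so every eigenvalue is listed, and as often as its multiplicity. Values of
  \<open>lam\<close> and \<open>ut\<close> at other indices are irrelevant.\<close>

definition ritz_pair :: "real^'n^'n \<Rightarrow> (real^'n) set \<Rightarrow> real \<Rightarrow> real^'n \<Rightarrow> bool" where
  "ritz_pair A W l v \<longleftrightarrow>
     v \<in> W \<and> A_norm A v = 1 \<and> (\<forall>w\<in>W. (A *v v) \<bullet> w = l * (v \<bullet> w))"

definition ritz_list ::
  "real^'n^'n \<Rightarrow> (real^'n) set \<Rightarrow> (nat \<Rightarrow> real) \<Rightarrow> (nat \<Rightarrow> real^'n) \<Rightarrow> bool" where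
  "ritz_list A W lam ut \<longleftrightarrow>
     (\<forall>j\<in>{1..dim W}. ritz_pair A W (lam j) (ut j)) \<and>
     (\<forall>j\<in>{1..dim W}. \<forall>k\<in>{1..dim W}. j \<noteq> k \<longrightarrow> A_inner A (ut j) (ut k) = 0) \<and>
     mono_on {1..dim W} lam"

text \<open>One step of the inverse power method for one eigenvector on \<open>K\<close>, from \<open>u0\<close> to \<open>u1\<close>:
  \<open>lam\<close>, \<open>ut\<close> are the listed Ritz values and vectors on \<open>K + span {u0}\<close> and \<open>i\<close> is the selected
  index. The size of the projection of a Ritz vector in the direction of \<open>u0\<close> is measured by its
  \<open>A\<close>-norm, hence is insensitive to the signs of the Ritz vectors; ties are broken arbitrarily.\<close>

definition inverse_power_step ::
  "real^'n^'n \<Rightarrow> (real^'n) set \<Rightarrow> real^'n \<Rightarrow> (nat \<Rightarrow> real) \<Rightarrow> (nat \<Rightarrow> real^'n) \<Rightarrow> nat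
     \<Rightarrow> real^'n \<Rightarrow> bool" where
  "inverse_power_step A K u0 lam ut i u1 \<longleftrightarrow>
     ritz_list A (K + span {u0}) lam ut \<and>
     i \<in> {1..dim (K + span {u0})} \<and>
     (\<forall>j\<in>{1..dim (K + span {u0})}.
        A_norm A (A_proj A (span {u0}) (ut j)) \<le> A_norm A (A_proj A (span {u0}) (ut i))) \<and>
     A *v u1 = lam i *\<^sub>R ut i"

end

theory Submission
  imports Defs
begin

text \<open>Write \<open>P\<close> for the energy projection onto \<open>K'\<close>, \<open>w\<close> for the selected Ritz vector,
  \<open>\<nu>\<close> for its Ritz value and \<open>c = (u, w)\<^sub>A\<close>. The error of the step factors into two estimates
  that meet in the Euclidean norm of \<open>u - c w\<close>.

  Accuracy of the Ritz vector (\<open>ritz_vector_error\<close>). The Euclidean norm of the Galerkin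
  residual \<open>u - P u\<close> is at most \<open>\<eta>\<close> times its energy norm (\<open>Aubin_Nitsche\<close>). The rest
  \<open>P u - c w\<close> lies in the span of the other Ritz vectors. Their inverse Ritz values keep the
  distance \<open>\<delta>\<close> from \<open>\<mu>\<close>, so this part is driven by the residual and at most \<open>\<mu>\<^sub>1 / \<delta>\<close> times
  as large in the Euclidean norm (\<open>ritz_component_error\<close>). Together,
  \<open>\<parallel>u - c w\<parallel>\<^sub>2 \<le> \<eta>\<^sub>i \<parallel>u - P u\<parallel>\<^sub>A\<close>.

  Gain of the linear solve (\<open>inverse_step_error\<close>). Applying \<open>A\<inverse>\<close> turns the Euclidean norm
  back into the energy norm at the price of \<open>1 / sqrt \<lambda>\<^sub>1\<close>. A direct comparison of \<open>u\<close> with the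
  multiple \<open>(c \<lambda> / \<nu>) u\<^sub>1\<close> would give the factor \<open>\<lambda>\<close>, which exceeds
  \<open>sqrt (\<lambda> \<nu>)\<close> when \<open>\<nu> < \<lambda>\<close>. The geometric mean comes from bounding the sine of the angle
  between \<open>u\<close> and \<open>u\<^sub>1\<close> through the component of \<open>u\<^sub>1\<close> orthogonal to \<open>u\<close>.

  Finally \<open>u - P u\<close> is no larger than the error of projecting onto the line through \<open>u\<^sub>0\<close>,
  because \<open>K'\<close> contains that line, and \<open>\<theta> \<ge> 1\<close>.\<close>

section \<open>The energy inner product\<close>

lemma A_inner_right:
  "A_inner A x (y + z) = A_inner A x y + A_inner A x z"
  "A_inner A x (y - z) = A_inner A x y - A_inner A x z"
  "A_inner A x (c *\<^sub>R y) = c * A_inner A x y"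
  "A_inner A x 0 = 0"
  "A_inner A x (sum f J) = (\<Sum>j\<in>J. A_inner A x (f j))"
  using matrix_vector_mul_linear[of A]
  by (simp_all add: A_inner_def linear_add linear_diff linear_scale linear_sum
      inner_add_right inner_diff_right inner_sum_right)

lemma A_inner_left:
  "A_inner A (x + y) z = A_inner A x z + A_inner A y z"
  "A_inner A (x - y) z = A_inner A x z - A_inner A y z"
  "A_inner A (c *\<^sub>R x) z = c * A_inner A x z"
  "A_inner A 0 z = 0"
  "A_inner A (sum f J) z = (\<Sum>j\<in>J. A_inner A (f j) z)"
  by (simp_all add: A_inner_def inner_add_left inner_diff_left inner_sum_left)

context
  fixes A :: "real^'n^'n"
  assumes spd: "sym_pos_def A"
begin

lemma A_inner_commute: "A_inner A x y = A_inner A y x"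
proof -
  have "transpose A = A" using spd by (simp add: sym_pos_def_def)
  then have "x v* A = A *v x" by (metis transpose_matrix_vector)
  then show ?thesis by (metis A_inner_def dot_lmul_matrix inner_commute)
qed

lemma A_inner_eq: "A_inner A x y = (A *v x) \<bullet> y"
  by (metis A_inner_commute A_inner_def inner_commute)

lemma A_inner_pos: "x \<noteq> 0 \<Longrightarrow> 0 < A_inner A x x"
  using spd by (simp add: sym_pos_def_def A_inner_def)

lemma A_inner_nonneg: "0 \<le> A_inner A x x"
  using A_inner_pos[of x] by (cases "x = 0") (auto simp: A_inner_left)

lemma A_norm_nonneg: "0 \<le> A_norm A x"
  by (simp add: A_norm_def A_inner_nonneg)

lemma A_norm_square: "(A_norm A x)\<^sup>2 = A_inner A x x"
  by (simp add: A_norm_def A_inner_nonneg)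

lemma A_norm_scaleR: "A_norm A (c *\<^sub>R x) = \<bar>c\<bar> * A_norm A x"
  by (simp add: A_norm_def A_inner_left A_inner_right real_sqrt_mult mult.assoc[symmetric])

lemma A_Cauchy_Schwarz: "A_inner A x y \<le> A_norm A x * A_norm A y"
proof (cases "y = 0")
  case True
  then show ?thesis by (simp add: A_norm_def A_inner_right)
next
  case False
  let ?a = "A_inner A x x" and ?b = "A_inner A y y" and ?c = "A_inner A x y"
  have b: "0 < ?b" using False by (rule A_inner_pos)
  have "0 \<le> A_inner A (?b *\<^sub>R x - ?c *\<^sub>R y) (?b *\<^sub>R x - ?c *\<^sub>R y)"
    by (rule A_inner_nonneg)
  also have "\<dots> = ?b * (?a * ?b - ?c\<^sup>2)"
    using A_inner_commute[of y x]
    by (simp add: A_inner_left A_inner_right algebra_simps power2_eq_square)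
  finally have "?c\<^sup>2 \<le> ?a * ?b" using b by (simp add: zero_le_mult_iff)
  then have "?c \<le> sqrt (?a * ?b)" by (rule real_le_rsqrt)
  then show ?thesis by (simp add: A_norm_def real_sqrt_mult)
qed

lemma inj_A: "inj ((*v) A)"
proof (rule injI)
  fix x y
  assume "A *v x = A *v y"
  then have "A_inner A (x - y) (x - y) = 0"
    by (simp add: A_inner_def matrix_vector_mult_diff_distrib)
  then show "x = y" using A_inner_pos[of "x - y"] by fastforce
qed

lemma A_mult_inv: "A *v (matrix_inv A *v g) = g"
proof -
  have "invertible A"
    using inj_A matrix_left_invertible_injective invertible_left_inverse by blast
  then have "A ** matrix_inv A = mat 1"
    unfolding invertible_def matrix_inv_def by (rule someI2_ex) blast
  then show ?thesis by (simp add: matrix_vector_mul_assoc)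
qed

lemma A_inv_mult: "matrix_inv A *v (A *v x) = x"
  using inj_A A_mult_inv[of "A *v x"] by (auto dest: injD)

lemma eigenvalue_pos:
  assumes "eigenpair A l v"
  shows "0 < l"
proof -
  have "v \<noteq> 0" and "A_inner A v v = l * (v \<bullet> v)"
    using assms by (simp_all add: eigenpair_def A_inner_def)
  then show ?thesis
    using A_inner_pos[of v] by (metis inner_gt_zero_iff zero_less_mult_pos2)
qed

text \<open>A minimiser \<open>v\<close> of the quadratic form on the unit sphere is an eigenvector: with the
  minimum \<open>l\<close>, the form of \<open>A - l I\<close> is nonnegative and vanishes at \<open>v\<close>, and moving from \<open>v\<close>
  against the residual \<open>A v - l v\<close> would make it negative if the residual did not vanish.
  The minimum is therefore an eigenvalue, so at least the smallest one.\<close>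

lemma Rayleigh_lower_bound:
  assumes "smallest_eigenvalue A l1"
  shows "l1 * (x \<bullet> x) \<le> A_inner A x x"
proof -
  have cont: "continuous_on (sphere 0 1) (\<lambda>x. A_inner A x x)"
    unfolding A_inner_def
    by (intro continuous_on_inner continuous_on_id
        linear_continuous_on matrix_vector_mul_bounded_linear)
  have "sphere (0::real^'n) 1 \<noteq> {}" by simp
  from continuous_attains_inf[OF compact_sphere this cont]
  obtain v :: "real^'n" where v: "norm v = 1"
    and vmin: "\<And>y. norm y = 1 \<Longrightarrow> A_inner A v v \<le> A_inner A y y"
    by auto
  define l where "l = A_inner A v v"
  have low: "l * (y \<bullet> y) \<le> A_inner A y y" for y
  proof (cases "y = 0")
    case True
    then show ?thesis by (simp add: A_inner_left)
  next
    case False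
    have "l \<le> A_inner A ((1 / norm y) *\<^sub>R y) ((1 / norm y) *\<^sub>R y)"
      unfolding l_def using False by (intro vmin) simp
    also have "\<dots> = A_inner A y y / (y \<bullet> y)"
      by (simp add: A_inner_left A_inner_right dot_square_norm power2_eq_square)
    finally show ?thesis using False by (simp add: field_simps)
  qed
  define w where "w = A *v v - l *\<^sub>R v"
  define q where "q = A_inner A w w - l * (w \<bullet> w)"
  define s where "s = w \<bullet> w"
  have vv: "v \<bullet> v = 1" using v by (simp add: dot_square_norm)
  have vw: "A_inner A v w - l * (v \<bullet> w) = s"
    by (simp add: A_inner_eq s_def w_def inner_diff_left)
  have q: "0 \<le> q" using low by (simp add: q_def)
  have quad: "0 \<le> 2 * t * s + t\<^sup>2 * q" for t
  proof -
    have "A_inner A (v + t *\<^sub>R w) (v + t *\<^sub>R w) - l * ((v + t *\<^sub>R w) \<bullet> (v + t *\<^sub>R w))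
        = 2 * t * (A_inner A v w - l * (v \<bullet> w)) + t\<^sup>2 * q"
      using A_inner_commute[of w v] vv
      by (simp add: A_inner_left A_inner_right inner_add_left inner_add_right inner_commute[of w v]
          q_def l_def algebra_simps power2_eq_square)
    then show ?thesis using low[of "v + t *\<^sub>R w"] vw by simp
  qed
  have "s = 0"
  proof (rule ccontr)
    assume s: "s \<noteq> 0"
    \<comment> \<open>The step \<open>- s / q\<close> minimises the quadratic, but \<open>q\<close> may be \<open>0\<close>.\<close>
    have "2 * (- s / (q + 1)) * s + (- s / (q + 1))\<^sup>2 * q = - (s\<^sup>2 * (q + 2)) / (q + 1)\<^sup>2"
      using q by (simp add: divide_simps) (simp add: algebra_simps power2_eq_square)
    also have "\<dots> < 0"
      using q s by (intro divide_neg_pos) auto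
    finally show False using quad[of "- s / (q + 1)"] by simp
  qed
  then have "A *v v = l *\<^sub>R v" by (simp add: s_def w_def)
  moreover have "v \<noteq> 0" using v by auto
  ultimately have "eigenpair A l v" by (simp add: eigenpair_def)
  then have "l1 \<le> l" using assms by (auto simp: smallest_eigenvalue_def)
  then have "l1 * (x \<bullet> x) \<le> l * (x \<bullet> x)" by (simp add: mult_right_mono)
  then show ?thesis using low[of x] by linarith
qed

text \<open>The form in which the linear solve gains smoothness: with \<open>g = A x\<close> it bounds the energy of
  \<open>A\<inverse> g\<close> by the Euclidean norm of \<open>g\<close>. It follows by Cauchy-Schwarz from the Rayleigh bound.\<close>

lemma A_inner_le_norm_mult:
  assumes "smallest_eigenvalue A l1"
  shows "l1 * A_inner A x x \<le> (norm (A *v x))\<^sup>2"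
proof (cases "x = 0")
  case True
  then show ?thesis by (simp add: A_inner_left)
next
  case False
  have l1: "0 \<le> l1"
    using assms eigenvalue_pos by (fastforce simp: smallest_eigenvalue_def)
  let ?e = "A_inner A x x"
  have e: "0 < ?e" using False by (rule A_inner_pos)
  have "?e \<le> norm x * norm (A *v x)"
    unfolding A_inner_def by (rule norm_cauchy_schwarz)
  then have "?e\<^sup>2 \<le> (norm x * norm (A *v x))\<^sup>2"
    using e by (intro power_mono) auto
  then have "l1 * ?e\<^sup>2 \<le> l1 * (x \<bullet> x) * (norm (A *v x))\<^sup>2"
    using l1 by (simp add: power_mult_distrib dot_square_norm mult.assoc mult_left_mono)
  also have "\<dots> \<le> ?e * (norm (A *v x))\<^sup>2"
    using Rayleigh_lower_bound[OF assms] by (intro mult_right_mono) auto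
  finally show ?thesis using e by (simp add: power2_eq_square algebra_simps)
qed

section \<open>Energy projections and the approximation constant\<close>

lemma A_proj_eqI:
  assumes "subspace W" "p \<in> W" "\<And>y. y \<in> W \<Longrightarrow> A_inner A p y = A_inner A x y"
  shows "A_proj A W x = p"
  unfolding A_proj_def
proof (rule the_equality)
  show "p \<in> W \<and> (\<forall>y\<in>W. A_inner A p y = A_inner A x y)" using assms by auto
next
  fix q
  assume q: "q \<in> W \<and> (\<forall>y\<in>W. A_inner A q y = A_inner A x y)"
  have "q - p \<in> W" using assms(1,2) q by (auto intro: subspace_diff)
  then have "A_inner A (q - p) (q - p) = 0" using q assms(3) by (simp add: A_inner_left(2))
  then show "q = p" using A_inner_pos[of "q - p"] by fastforce
qed

text \<open>The energy complement of \<open>W\<close> is the Euclidean complement of the image of \<open>W\<close> under \<open>A\<close>.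
  That image has the dimension of \<open>W\<close>, so the two spaces have complementary dimensions; they
  meet only in \<open>0\<close>, hence span everything.\<close>

lemma A_orthogonal_decomposition:
  assumes W: "subspace W"
  obtains p where "p \<in> W" "\<And>y. y \<in> W \<Longrightarrow> A_inner A p y = A_inner A x y"
proof -
  let ?AW = "(*v) A ` W"
  define C where "C = {y \<in> UNIV. \<forall>z\<in>?AW. orthogonal z y}"
  have AW: "subspace ?AW"
    by (rule linear_subspace_image[OF matrix_vector_mul_linear W])
  have C: "subspace C"
    unfolding C_def using subspace_orthogonal_to_vectors[of ?AW] by simp
  have mem_C: "y \<in> C \<longleftrightarrow> (\<forall>z\<in>W. A_inner A z y = 0)" for y
    by (auto simp: C_def orthogonal_def A_inner_eq)
  have "dim ?AW = dim W"
    using inj_A by (intro dim_image_eq matrix_vector_mul_linear) (auto intro: inj_on_subset)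
  moreover have "dim C + dim ?AW = dim (UNIV :: (real^'n) set)"
    unfolding C_def by (rule dim_subspace_orthogonal_to_vectors[OF AW]) auto
  moreover have "W \<inter> C = {0}"
    using subspace_0[OF W] subspace_0[OF C] A_inner_pos by (fastforce simp: mem_C)
  ultimately have "dim {x + y |x y. x \<in> W \<and> y \<in> C} = dim (UNIV :: (real^'n) set)"
    using dim_sums_Int[OF W C] by simp
  then have "{x + y |x y. x \<in> W \<and> y \<in> C} = UNIV"
    using subspace_sums[OF W C] by (intro subspace_dim_equal) auto
  then obtain p c where pc: "p \<in> W" "c \<in> C" "x = p + c" by blast
  show thesis
  proof (rule that[OF pc(1)])
    fix y
    assume "y \<in> W"
    then have "A_inner A c y = 0" using pc(2) A_inner_commute[of c y] by (simp add: mem_C)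
    then show "A_inner A p y = A_inner A x y" by (simp add: pc(3) A_inner_left)
  qed
qed

lemma A_proj_mem: "subspace W \<Longrightarrow> A_proj A W x \<in> W"
  by (metis A_orthogonal_decomposition A_proj_eqI)

lemma A_inner_A_proj: "subspace W \<Longrightarrow> y \<in> W \<Longrightarrow> A_inner A (A_proj A W x) y = A_inner A x y"
  by (metis A_orthogonal_decomposition A_proj_eqI)

lemma A_proj_residual_orthogonal:
  "subspace W \<Longrightarrow> y \<in> W \<Longrightarrow> A_inner A (x - A_proj A W x) y = 0"
  by (simp add: A_inner_left A_inner_A_proj)

lemma A_proj_scaleR: "subspace W \<Longrightarrow> A_proj A W (c *\<^sub>R x) = c *\<^sub>R A_proj A W x"
  by (rule A_proj_eqI) (auto simp: A_inner_left A_inner_A_proj A_proj_mem subspace_scale)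

lemma A_proj_best:
  assumes W: "subspace W" and v: "v \<in> W"
  shows "A_norm A (x - A_proj A W x) \<le> A_norm A (x - v)"
proof -
  let ?r = "x - A_proj A W x" and ?d = "A_proj A W x - v"
  have "?d \<in> W" using W v A_proj_mem by (auto intro: subspace_diff)
  then have "A_inner A ?r ?d = 0" by (rule A_proj_residual_orthogonal[OF W])
  then have "A_inner A (?r + ?d) (?r + ?d) = A_inner A ?r ?r + A_inner A ?d ?d"
    using A_inner_commute[of ?d ?r] by (simp only: A_inner_left(1) A_inner_right(1))
  then show ?thesis using A_inner_nonneg[of ?d] by (simp add: A_norm_def)
qed

lemma eta_bdd_above:
  assumes W: "subspace W"
  shows "bdd_above ((\<lambda>g. A_norm A (matrix_inv A *v g - A_proj A W (matrix_inv A *v g)))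
           ` {g. norm g = 1})"
proof -
  obtain B where B: "\<And>g. norm (matrix_inv A *v g) \<le> norm g * B"
    using bounded_linear.bounded[OF matrix_vector_mul_bounded_linear[of "matrix_inv A"]] by blast
  have "A_norm A (matrix_inv A *v g - A_proj A W (matrix_inv A *v g)) \<le> sqrt B"
    if g: "norm g = 1" for g
  proof -
    let ?x = "matrix_inv A *v g"
    have "A_inner A ?x ?x \<le> norm ?x * norm g"
      unfolding A_inner_def A_mult_inv by (rule norm_cauchy_schwarz)
    then have "A_norm A ?x \<le> sqrt B"
      using g B[of g] by (simp add: A_norm_def)
    moreover have "A_norm A (?x - A_proj A W ?x) \<le> A_norm A ?x"
      using A_proj_best[OF W subspace_0[OF W], of ?x] by simp
    ultimately show ?thesis by linarith
  qed
  then show ?thesis by (intro bdd_aboveI[of _ "sqrt B"]) auto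
qed

lemma eta_nonneg:
  assumes W: "subspace W"
  shows "0 \<le> eta A W"
proof -
  obtain g :: "real^'n" where g: "norm g = 1"
    using vector_choose_size[of 1] by auto
  have "A_norm A (matrix_inv A *v g - A_proj A W (matrix_inv A *v g)) \<le> eta A W"
    unfolding eta_def using g by (intro cSUP_upper eta_bdd_above W) simp
  then show ?thesis using A_norm_nonneg order_trans by blast
qed

text \<open>The definition of \<open>\<eta>\<close>, rescaled to arbitrary \<open>x = A\<inverse> g\<close>.\<close>

lemma A_norm_residual_le_eta:
  assumes W: "subspace W"
  shows "A_norm A (x - A_proj A W x) \<le> eta A W * norm (A *v x)"
proof (cases "x = 0")
  case True
  then show ?thesis
    using A_proj_best[OF W subspace_0[OF W], of x] by (simp add: A_norm_def A_inner_left)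
next
  case False
  let ?n = "norm (A *v x)" and ?g = "(1 / norm (A *v x)) *\<^sub>R (A *v x)"
  have "A *v x \<noteq> 0" using False inj_A by (metis injD matrix_vector_mult_0_right)
  then have n: "0 < ?n" by simp
  have inv: "matrix_inv A *v ?g = (1 / ?n) *\<^sub>R x"
    by (simp add: matrix_vector_mult_scaleR A_inv_mult)
  have "A_norm A (matrix_inv A *v ?g - A_proj A W (matrix_inv A *v ?g)) \<le> eta A W"
    unfolding eta_def using n by (intro cSUP_upper eta_bdd_above W) simp
  then have "(1 / ?n) * A_norm A (x - A_proj A W x) \<le> eta A W"
    unfolding inv A_proj_scaleR[OF W] scaleR_right_diff_distrib[symmetric] A_norm_scaleR
    using n by simp
  then show ?thesis using n by (simp add: field_simps)
qed

text \<open>The duality argument of Aubin and Nitsche: the residual \<open>r\<close> is tested against the solution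
  \<open>x\<close> of \<open>A x = r\<close>, and by Galerkin orthogonality only the residual of \<open>x\<close> contributes.\<close>

lemma Aubin_Nitsche:
  assumes W: "subspace W"
  shows "norm (u - A_proj A W u) \<le> eta A W * A_norm A (u - A_proj A W u)"
proof (cases "u - A_proj A W u = 0")
  case True
  then show ?thesis by (simp add: A_norm_def A_inner_left)
next
  case False
  define r where "r = u - A_proj A W u"
  define x where "x = matrix_inv A *v r"
  have Ax: "A *v x = r" by (simp add: x_def A_mult_inv)
  have "A_inner A r (A_proj A W x) = 0"
    unfolding r_def by (intro A_proj_residual_orthogonal W A_proj_mem)
  then have "r \<bullet> r = A_inner A (x - A_proj A W x) r"
    using A_inner_commute[of "A_proj A W x" r] by (simp add: A_inner_left A_inner_eq[of x] Ax)
  also have "\<dots> \<le> A_norm A (x - A_proj A W x) * A_norm A r"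
    by (rule A_Cauchy_Schwarz)
  also have "\<dots> \<le> eta A W * norm r * A_norm A r"
    using A_norm_residual_le_eta[OF W, of x] Ax by (intro mult_right_mono A_norm_nonneg) simp
  finally have "norm r * norm r \<le> norm r * (eta A W * A_norm A r)"
    by (simp add: dot_square_norm power2_eq_square algebra_simps)
  moreover have "0 < norm r" using False by (simp add: r_def)
  ultimately have "norm r \<le> eta A W * A_norm A r" by simp
  then show ?thesis by (simp add: r_def)
qed

section \<open>Ritz vectors\<close>

lemma ritz_pair_inner:
  "ritz_pair A W l v \<Longrightarrow> w \<in> W \<Longrightarrow> A_inner A v w = l * (v \<bullet> w)"
  by (simp add: ritz_pair_def A_inner_eq)

lemma ritz_pair_A_inner_self: "ritz_pair A W l v \<Longrightarrow> A_inner A v v = 1"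
  using A_norm_square[of v] by (simp add: ritz_pair_def)

lemma ritz_value_pos:
  assumes "ritz_pair A W l v"
  shows "0 < l"
proof -
  have "l * (v \<bullet> v) = 1"
    using ritz_pair_inner[OF assms] ritz_pair_A_inner_self[OF assms] assms
    by (simp add: ritz_pair_def)
  then show ?thesis
    by (metis inner_ge_zero zero_less_one mult_nonpos_nonneg not_le order_less_le_trans)
qed

text \<open>The listed vectors are independent, being orthonormal in the energy inner product, and there
  are as many as the dimension, so they form a basis; the coefficients are the Fourier
  coefficients.\<close>

lemma ritz_list_expansion:
  assumes W: "subspace W" and R: "ritz_list A W lam ut" and x: "x \<in> W"
  shows "x = (\<Sum>j\<in>{1..dim W}. A_inner A x (ut j) *\<^sub>R ut j)"
proof -
  let ?J = "{1..dim W}"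
  have one: "A_inner A (ut j) (ut j) = 1" if "j \<in> ?J" for j
    using R that ritz_pair_A_inner_self unfolding ritz_list_def by blast
  have zero: "A_inner A (ut j) (ut k) = 0" if "j \<in> ?J" "k \<in> ?J" "j \<noteq> k" for j k
    using R that unfolding ritz_list_def by blast
  have coeff: "A_inner A (\<Sum>j\<in>?J. a j *\<^sub>R ut j) (ut k) = a k" if k: "k \<in> ?J" for a k
  proof -
    have "A_inner A (\<Sum>j\<in>?J. a j *\<^sub>R ut j) (ut k) = (\<Sum>j\<in>?J. if j = k then a k else 0)"
      unfolding A_inner_left using one zero k by (intro sum.cong) auto
    then show ?thesis using k by simp
  qed
  have inj: "inj_on ut ?J"
  proof (rule inj_onI, rule ccontr)
    fix j k
    assume "j \<in> ?J" "k \<in> ?J" "ut j = ut k" "j \<noteq> k"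
    then show False using one[of j] zero[of j k] by simp
  qed
  have "independent (ut ` ?J)"
  proof (rule independent_if_scalars_zero)
    fix f b
    assume s: "(\<Sum>b\<in>ut ` ?J. f b *\<^sub>R b) = 0" and "b \<in> ut ` ?J"
    then obtain k where k: "k \<in> ?J" "b = ut k" by blast
    have "(\<Sum>j\<in>?J. f (ut j) *\<^sub>R ut j) = 0"
      using s by (simp add: sum.reindex[OF inj] del: One_nat_def)
    then have "f (ut k) = 0"
      using coeff[OF k(1), of "\<lambda>j. f (ut j)"] by (simp add: A_inner_left)
    then show "f b = 0" using k by simp
  qed simp
  moreover have "ut ` ?J \<subseteq> W" using R by (auto simp: ritz_list_def ritz_pair_def)
  moreover have "card (ut ` ?J) = dim W" using card_image[OF inj] by simp
  ultimately have "W \<subseteq> span (ut ` ?J)" by (intro card_ge_dim_independent) auto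
  then have "x \<in> range (\<lambda>f. \<Sum>b\<in>ut ` ?J. f b *\<^sub>R b)"
    using x span_finite[of "ut ` ?J"] by auto
  then obtain f where "x = (\<Sum>b\<in>ut ` ?J. f b *\<^sub>R b)" by blast
  then have f: "x = (\<Sum>j\<in>?J. f (ut j) *\<^sub>R ut j)"
    by (simp add: sum.reindex[OF inj] del: One_nat_def)
  show ?thesis
    using coeff[of _ "\<lambda>j. f (ut j)", folded f] by (subst f) (intro sum.cong, auto)
qed

text \<open>The residual \<open>r = u - P u\<close> sees a Ritz vector only through the gap between the
  inverses of its Ritz value and of the exact eigenvalue:
  \<open>(ut\<^sub>j, r) = (\<mu> - \<mu>\<^sub>j) (u, ut\<^sub>j)\<^sub>A\<close>. Ritz vectors are also orthogonal in the Euclidean inner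
  product, so \<open>z = \<Sum>\<^sub>j (ut\<^sub>j, r) ut\<^sub>j\<close>, taken over \<open>j \<noteq> i\<close>, is at least \<open>\<delta>\<close> times as long as
  \<open>P u - (u, ut\<^sub>i)\<^sub>A ut\<^sub>i\<close>; testing \<open>z\<close> against \<open>r\<close> bounds it by \<open>\<mu>\<^sub>1 \<parallel>r\<parallel>\<close>, which is the Bessel
  inequality for the vectors \<open>ut\<^sub>j\<close> of squared length \<open>\<mu>\<^sub>j \<le> \<mu>\<^sub>1\<close>.\<close>

lemma ritz_component_error:
  assumes W: "subspace W" and R: "ritz_list A W lam ut" and i: "i \<in> {1..dim W}"
    and u: "A *v u = l *\<^sub>R u" and l: "0 < l"
    and gap: "\<And>j. j \<in> {1..dim W} - {i} \<Longrightarrow> \<delta> \<le> \<bar>1 / lam j - 1 / l\<bar>" and \<delta>: "0 < \<delta>"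
  shows "\<delta> * norm (A_proj A W u - A_inner A u (ut i) *\<^sub>R ut i)
           \<le> 1 / lam 1 * norm (u - A_proj A W u)"
proof -
  let ?J = "{1..dim W}" and ?P = "A_proj A W u"
  define r where "r = u - ?P"
  define c where "c j = A_inner A u (ut j)" for j
  define b where "b j = ut j \<bullet> r" for j
  define d where "d = ?P - c i *\<^sub>R ut i"
  define z where "z = (\<Sum>j\<in>?J - {i}. b j *\<^sub>R ut j)"
  have rp: "ritz_pair A W (lam j) (ut j)" if "j \<in> ?J" for j
    using R that by (simp add: ritz_list_def)
  have pos: "0 < lam j" if "j \<in> ?J" for j using rp[OF that] by (rule ritz_value_pos)
  have mem: "ut j \<in> W" if "j \<in> ?J" for j using rp[OF that] by (simp add: ritz_pair_def)
  have P: "?P \<in> W" by (rule A_proj_mem[OF W])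
  have inner_ut: "ut j \<bullet> ut k = (if j = k then 1 / lam j else 0)" if "j \<in> ?J" "k \<in> ?J" for j k
  proof -
    have "A_inner A (ut j) (ut k) = (if j = k then 1 else 0)"
      using R that ritz_pair_A_inner_self[OF rp[OF that(1)]] by (auto simp: ritz_list_def)
    then show ?thesis
      using ritz_pair_inner[OF rp[OF that(1)] mem[OF that(2)]] pos[OF that(1)]
      by (auto simp: field_simps split: if_splits)
  qed
  have norm_comb: "(norm (\<Sum>j\<in>?J - {i}. a j *\<^sub>R ut j))\<^sup>2 = (\<Sum>j\<in>?J - {i}. (a j)\<^sup>2 / lam j)"
    for a
  proof -
    have "(norm (\<Sum>j\<in>?J - {i}. a j *\<^sub>R ut j))\<^sup>2
        = (\<Sum>j\<in>?J - {i}. \<Sum>k\<in>?J - {i}. a j * (a k * (ut k \<bullet> ut j)))"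
      by (simp add: dot_square_norm[symmetric] inner_sum_left inner_sum_right sum_distrib_left
          del: One_nat_def)
    also have "\<dots> = (\<Sum>j\<in>?J - {i}. \<Sum>k\<in>?J - {i}. if j = k then (a j)\<^sup>2 / lam j else 0)"
      by (intro sum.cong) (auto simp: inner_ut power2_eq_square simp del: One_nat_def)
    also have "\<dots> = (\<Sum>j\<in>?J - {i}. (a j)\<^sup>2 / lam j)"
      by (intro sum.cong) auto
    finally show ?thesis .
  qed
  have b: "b j = (1 / l - 1 / lam j) * c j" if j: "j \<in> ?J" for j
  proof -
    have "c j = l * (ut j \<bullet> u)"
      by (simp add: c_def A_inner_eq u inner_commute)
    moreover have "c j = lam j * (ut j \<bullet> ?P)"
      using A_inner_A_proj[OF W mem[OF j], of u] ritz_pair_inner[OF rp[OF j] P]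
      by (simp add: c_def A_inner_commute)
    ultimately show ?thesis
      using l pos[OF j] by (simp add: b_def r_def inner_diff_right field_simps)
  qed
  have "?P = (\<Sum>j\<in>?J. c j *\<^sub>R ut j)"
  proof (subst ritz_list_expansion[OF W R P], intro sum.cong refl)
    fix j
    assume "j \<in> ?J"
    then show "A_inner A ?P (ut j) *\<^sub>R ut j = c j *\<^sub>R ut j"
      unfolding c_def by (simp only: A_inner_A_proj[OF W mem])
  qed
  then have d: "d = (\<Sum>j\<in>?J - {i}. c j *\<^sub>R ut j)"
    using i sum.remove[of ?J i "\<lambda>j. c j *\<^sub>R ut j"] by (simp add: d_def)
  have one: "1 \<in> ?J" using i by auto
  have mu: "1 / lam j \<le> 1 / lam 1" if j: "j \<in> ?J" for j
  proof -
    have "lam 1 \<le> lam j"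
      using R j one by (auto simp: ritz_list_def mono_on_def)
    then show ?thesis using pos[OF one] by (simp add: frac_le)
  qed
  have "(\<delta> * norm d)\<^sup>2 = (\<Sum>j\<in>?J - {i}. (\<delta> * c j)\<^sup>2 / lam j)"
    unfolding d power_mult_distrib norm_comb by (simp add: sum_distrib_left)
  also have "\<dots> \<le> (\<Sum>j\<in>?J - {i}. (b j)\<^sup>2 / lam j)"
  proof (rule sum_mono)
    fix j
    assume j: "j \<in> ?J - {i}"
    have "\<bar>\<delta> * c j\<bar> \<le> \<bar>b j\<bar>"
      using gap[OF j] \<delta> j b[of j] by (auto simp: abs_mult abs_minus_commute intro!: mult_right_mono)
    then have "(\<delta> * c j)\<^sup>2 \<le> (b j)\<^sup>2" by (simp add: abs_le_square_iff)
    then show "(\<delta> * c j)\<^sup>2 / lam j \<le> (b j)\<^sup>2 / lam j"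
      using pos[of j] j by (intro divide_right_mono) auto
  qed
  also have "\<dots> = (norm z)\<^sup>2" unfolding z_def norm_comb ..
  finally have dz: "\<delta> * norm d \<le> norm z" by (rule power2_le_imp_le) simp
  have "(norm z)\<^sup>2 \<le> (\<Sum>j\<in>?J - {i}. 1 / lam 1 * (b j)\<^sup>2)"
    unfolding z_def norm_comb
  proof (rule sum_mono)
    fix j
    assume j: "j \<in> ?J - {i}"
    then have "1 / lam j * (b j)\<^sup>2 \<le> 1 / lam 1 * (b j)\<^sup>2"
      using mu[of j] by (intro mult_right_mono) auto
    then show "(b j)\<^sup>2 / lam j \<le> 1 / lam 1 * (b j)\<^sup>2" by simp
  qed
  also have "\<dots> = 1 / lam 1 * (z \<bullet> r)"
    by (simp add: z_def inner_sum_left b_def power2_eq_square sum_distrib_left)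
  also have "\<dots> \<le> 1 / lam 1 * (norm z * norm r)"
    using pos[OF one] by (intro mult_left_mono norm_cauchy_schwarz) simp
  finally have "norm z * norm z \<le> norm z * (1 / lam 1 * norm r)"
    by (simp add: power2_eq_square algebra_simps)
  then have "norm z \<le> 1 / lam 1 * norm r"
    using pos[OF one] unfolding mult_le_cancel_left by (cases "z = 0") auto
  then show ?thesis using dz by (simp add: d_def c_def r_def)
qed

lemma ritz_vector_error:
  assumes W: "subspace W" and R: "ritz_list A W lam ut" and i: "i \<in> {1..dim W}"
    and u: "A *v u = l *\<^sub>R u" and l: "0 < l"
    and gap: "\<And>j. j \<in> {1..dim W} - {i} \<Longrightarrow> \<delta> \<le> \<bar>1 / lam j - 1 / l\<bar>" and \<delta>: "0 < \<delta>"
  shows "norm (u - A_inner A u (ut i) *\<^sub>R ut i)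
           \<le> (1 + 1 / lam 1 / \<delta>) * eta A W * A_norm A (u - A_proj A W u)"
proof -
  let ?P = "A_proj A W u" and ?w = "A_inner A u (ut i) *\<^sub>R ut i"
  have lam1: "0 < lam 1"
    using R i by (intro ritz_value_pos[of W _ "ut 1"]) (auto simp: ritz_list_def)
  then have k: "0 \<le> 1 + 1 / lam 1 / \<delta>" using \<delta> by simp
  have "norm (u - ?w) \<le> norm (u - ?P) + norm (?P - ?w)"
    using norm_triangle_ineq[of "u - ?P" "?P - ?w"] by simp
  also have "\<dots> \<le> (1 + 1 / lam 1 / \<delta>) * norm (u - ?P)"
    using ritz_component_error[OF W R i u l gap \<delta>] \<delta> lam1
    by (simp add: field_simps del: One_nat_def)
  also have "\<dots> \<le> (1 + 1 / lam 1 / \<delta>) * (eta A W * A_norm A (u - ?P))"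
    using k by (intro mult_left_mono Aubin_Nitsche W)
  finally show ?thesis by (simp only: mult.assoc)
qed

section \<open>The linear solve\<close>

text \<open>Write \<open>c = (u, w)\<^sub>A\<close> and \<open>x = u\<^sub>1 - (u, u\<^sub>1)\<^sub>A u\<close>. The energy norm of \<open>u\<^sub>1\<close> is at least
  \<open>1\<close>, so the sine of the angle between \<open>u\<close> and \<open>u\<^sub>1\<close> is at most the energy norm of \<open>x\<close>, and
  \<open>A x = \<nu> (w - c u)\<close>. This bounds the sine by \<open>w - c u\<close> instead of \<open>u - c w\<close>; the exchange
  costs nothing because
  \<open>\<lambda> \<nu> \<parallel>u - c w\<parallel>\<^sup>2 - \<nu>\<^sup>2 \<parallel>w - c u\<parallel>\<^sup>2 = c\<^sup>2 (\<lambda> - \<nu>)\<^sup>2 / \<lambda>\<close> is nonnegative. The geometric mean of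
  \<open>\<lambda>\<close> and \<open>\<nu>\<close> in the bound comes from this identity.\<close>

lemma inverse_step_error:
  assumes l1: "smallest_eigenvalue A l1"
    and u: "A *v u = l *\<^sub>R u" "A_norm A u = 1" and l: "0 < l"
    and w: "A_norm A w = 1" "\<nu> * (w \<bullet> w) = 1" and u1: "A *v u1 = \<nu> *\<^sub>R w"
  shows "A_norm A (u - A_proj A (span {u1}) u)
           \<le> sqrt (l * \<nu> / l1) * norm (u - A_inner A u w *\<^sub>R w)"
proof -
  define c where "c = A_inner A u w"
  define a where "a = A_inner A u u1"
  define N where "N = A_inner A u1 u1"
  define x where "x = u1 - a *\<^sub>R u"
  have l1_pos: "0 < l1"
    using l1 eigenvalue_pos by (auto simp: smallest_eigenvalue_def)
  have \<nu>: "0 < \<nu>"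
    using w(2) by (metis inner_ge_zero zero_less_one mult_nonpos_nonneg not_le order_less_le_trans)
  have uu: "A_inner A u u = 1" using A_norm_square[of u] u(2) by simp
  have ww: "w \<bullet> w = 1 / \<nu>" using w(2) \<nu> by (simp add: field_simps)
  have uw: "u \<bullet> w = c / l"
    using l by (simp add: c_def A_inner_eq u(1))
  have u_norm: "u \<bullet> u = 1 / l"
    using uu l by (simp add: A_inner_eq u(1) field_simps)
  have a: "a = \<nu> * c / l"
    using uw by (simp add: a_def A_inner_def u1)
  have "1 = A_inner A w u1" using w(2) by (simp add: A_inner_def u1)
  also have "\<dots> \<le> A_norm A u1"
    using A_Cauchy_Schwarz[of w u1] w(1) by simp
  finally have N: "1 \<le> N"
    using power_mono[of 1 "A_norm A u1" 2] by (simp add: N_def A_norm_square)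
  \<comment> \<open>The distance of \<open>u\<close> from the line through \<open>u\<^sub>1\<close>, by the best approximation \<open>(a / N) u\<^sub>1\<close>.\<close>
  have "(A_norm A (u - A_proj A (span {u1}) u))\<^sup>2 \<le> (A_norm A (u - (a / N) *\<^sub>R u1))\<^sup>2"
    by (intro power_mono A_proj_best subspace_span span_scale span_base A_norm_nonneg) simp
  also have "\<dots> = (N - a\<^sup>2) / N"
    unfolding A_norm_square using N A_inner_commute[of u1 u] uu
    by (simp add: A_inner_left A_inner_right a_def[symmetric] N_def[symmetric]
        field_simps power2_eq_square)
  also have "\<dots> = A_inner A x x / N"
    using A_inner_commute[of u1 u] uu
    by (simp add: x_def A_inner_left A_inner_right a_def[symmetric] N_def[symmetric]
        power2_eq_square algebra_simps)
  also have "\<dots> \<le> A_inner A x x"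
    using N A_inner_nonneg[of x] by (simp add: divide_le_eq mult_le_cancel_left1)
  also have "\<dots> \<le> (norm (A *v x))\<^sup>2 / l1"
    using A_inner_le_norm_mult[OF l1, of x] l1_pos by (simp add: field_simps)
  also have "A *v x = \<nu> *\<^sub>R (w - c *\<^sub>R u)"
    using l by (simp add: x_def matrix_vector_mult_diff_distrib matrix_vector_mult_scaleR u1 u(1) a
        algebra_simps)
  also have "(norm (\<nu> *\<^sub>R (w - c *\<^sub>R u)))\<^sup>2 / l1 \<le> l * \<nu> * (norm (u - c *\<^sub>R w))\<^sup>2 / l1"
  proof (intro divide_right_mono)
    have ucw: "(norm (u - c *\<^sub>R w))\<^sup>2 = 1 / l - 2 * c * (c / l) + c\<^sup>2 / \<nu>"
      unfolding dot_square_norm[symmetric]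
      by (simp add: inner_diff_left inner_diff_right inner_commute[of w u]
          uw ww u_norm power2_eq_square right_diff_distrib)
    have wcu: "(norm (\<nu> *\<^sub>R (w - c *\<^sub>R u)))\<^sup>2 = \<nu>\<^sup>2 * (1 / \<nu> - 2 * c * (c / l) + c\<^sup>2 / l)"
      unfolding norm_scaleR power_mult_distrib dot_square_norm[symmetric]
      by (simp add: inner_diff_left inner_diff_right inner_commute[of w u]
          uw ww u_norm power2_eq_square right_diff_distrib)
    have "l * \<nu> * (norm (u - c *\<^sub>R w))\<^sup>2 = \<nu> - 2 * \<nu> * c\<^sup>2 + l * c\<^sup>2"
      unfolding ucw using l \<nu> by (simp add: algebra_simps power2_eq_square)
    moreover have "(norm (\<nu> *\<^sub>R (w - c *\<^sub>R u)))\<^sup>2 = \<nu> - \<nu>\<^sup>2 * c\<^sup>2 / l"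
      unfolding wcu using l \<nu> by (simp add: algebra_simps power2_eq_square)
    moreover have "c\<^sup>2 * (l - \<nu>)\<^sup>2 / l = l * c\<^sup>2 - 2 * \<nu> * c\<^sup>2 + \<nu>\<^sup>2 * c\<^sup>2 / l"
      using l by (simp add: field_simps power2_eq_square)
    ultimately have "l * \<nu> * (norm (u - c *\<^sub>R w))\<^sup>2 - (norm (\<nu> *\<^sub>R (w - c *\<^sub>R u)))\<^sup>2
        = c\<^sup>2 * (l - \<nu>)\<^sup>2 / l"
      by linarith
    also have "\<dots> \<ge> 0" using l by simp
    finally show "(norm (\<nu> *\<^sub>R (w - c *\<^sub>R u)))\<^sup>2 \<le> l * \<nu> * (norm (u - c *\<^sub>R w))\<^sup>2" by simp
  qed (use l1_pos in simp)
  also have "\<dots> = (sqrt (l * \<nu> / l1) * norm (u - c *\<^sub>R w))\<^sup>2"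
    using l \<nu> l1_pos by (simp add: power_mult_distrib)
  finally show ?thesis
    unfolding c_def[symmetric] by (rule power2_le_imp_le) (use l \<nu> l1_pos in simp)
qed

end

section \<open>One step of the inverse power method\<close>

theorem theorem4p2:
  fixes A :: "real^'n^'n"
    and K K' :: "(real^'n) set"
    and u0 u u1 :: "real^'n"
    and ut :: "nat \<Rightarrow> real^'n"
    and lamR muR :: "nat \<Rightarrow> real"
    and lam1 lam mu \<delta> \<theta> \<eta>i :: real
    and i m :: nat
  assumes "sym_pos_def A"
    and "smallest_eigenvalue A lam1"
    and "subspace K"
    and "u0 \<noteq> 0"
    and "eigenpair A lam u"
    and "is_arg_min (\<lambda>v. A_norm A (v - A_proj A (span {u0}) v))
           (\<lambda>v. (\<exists>l. eigenpair A l v) \<and> A_norm A v = 1) u"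
    and "mu = 1 / lam"
    and "K' = K + span {u0}"
    and "m = dim K'"
    and "m \<ge> 2"
    and "inverse_power_step A K u0 lamR ut i u1"
    and "\<And>j. j \<in> {1..m} \<Longrightarrow> muR j = 1 / lamR j"
    and "\<delta> = Min ((\<lambda>j. \<bar>muR j - mu\<bar>) ` ({1..m} - {i}))"
    and "\<delta> > 0"
    and "\<theta> = sqrt (1 + muR 1 * (eta A K')^2 / \<delta>^2)"
    and "\<eta>i = (1 + muR 1 / \<delta>) * eta A K'"
  shows "A_norm A (u - A_proj A (span {u1}) u)
           \<le> \<theta> * sqrt (lam * lamR i / lam1) * \<eta>i * A_norm A (u - A_proj A (span {u0}) u)"
proof -
  note spd = assms(1)
  have K'_sums: "K' = {x + y |x y. x \<in> K \<and> y \<in> span {u0}}"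
    unfolding assms(8) set_plus_def by blast
  have K': "subspace K'"
    unfolding K'_sums by (intro subspace_sums assms(3) subspace_span)
  have R: "ritz_list A K' lamR ut" and i: "i \<in> {1..dim K'}" and Au1: "A *v u1 = lamR i *\<^sub>R ut i"
    using assms(11) by (simp_all add: inverse_power_step_def assms(8))
  have u: "A *v u = lam *\<^sub>R u" using assms(5) by (simp add: eigenpair_def)
  have u_norm: "A_norm A u = 1" using assms(6) by (simp add: is_arg_min_def)
  have lam: "0 < lam" by (rule eigenvalue_pos[OF spd assms(5)])
  have lam1: "0 < lam1"
    using assms(2) eigenvalue_pos[OF spd] by (auto simp: smallest_eigenvalue_def)
  have rp: "ritz_pair A K' (lamR i) (ut i)" using R i by (simp add: ritz_list_def)
  have "0 < lamR i" by (rule ritz_value_pos[OF spd rp])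
  then have s: "0 \<le> sqrt (lam * lamR i / lam1)" using lam lam1 by simp
  have one: "1 \<in> {1..m}" using assms(10) by simp
  have mu1: "muR 1 = 1 / lamR 1" by (rule assms(12)[OF one])
  have "0 < lamR 1"
    using R one assms(9) by (intro ritz_value_pos[OF spd, of K' _ "ut 1"]) (auto simp: ritz_list_def)
  then have mu1_pos: "0 \<le> muR 1" unfolding mu1 by simp
  have \<theta>: "1 \<le> \<theta>" unfolding assms(15) using mu1_pos by simp
  have \<eta>i: "0 \<le> \<eta>i"
    unfolding assms(16) using mu1_pos assms(14) eta_nonneg[OF spd K'] by simp
  have gap: "\<delta> \<le> \<bar>1 / lamR j - 1 / lam\<bar>" if "j \<in> {1..dim K'} - {i}" for j
  proof -
    have j: "j \<in> {1..m} - {i}" using that assms(9) by simp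
    then have "\<delta> \<le> \<bar>muR j - mu\<bar>" unfolding assms(13) by (intro Min_le) auto
    then show ?thesis using assms(12)[of j] j assms(7) by simp
  qed
  have u0_K': "span {u0} \<subseteq> K'"
    unfolding K'_sums using subspace_0[OF assms(3)] by force
  have "A_norm A (u - A_proj A (span {u1}) u)
      \<le> sqrt (lam * lamR i / lam1) * norm (u - A_inner A u (ut i) *\<^sub>R ut i)"
  proof (rule inverse_step_error[OF spd assms(2) u u_norm lam _ _ Au1])
    show "A_norm A (ut i) = 1" using rp by (simp add: ritz_pair_def)
    have "ut i \<in> K'" using rp by (simp add: ritz_pair_def)
    then show "lamR i * (ut i \<bullet> ut i) = 1"
      using ritz_pair_inner[OF spd rp] ritz_pair_A_inner_self[OF spd rp] by simp
  qed
  also have "\<dots> \<le> sqrt (lam * lamR i / lam1) * (\<eta>i * A_norm A (u - A_proj A K' u))"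
    using ritz_vector_error[OF spd K' R i u lam gap assms(14)] s
    by (intro mult_left_mono) (simp_all add: assms(16) mu1 del: One_nat_def)
  also have "\<dots> \<le> sqrt (lam * lamR i / lam1) * (\<eta>i * A_norm A (u - A_proj A (span {u0}) u))"
    using u0_K' A_proj_mem[OF spd subspace_span] s \<eta>i
    by (intro mult_left_mono A_proj_best[OF spd K']) auto
  also have "\<dots> \<le> \<theta> * (sqrt (lam * lamR i / lam1) * (\<eta>i * A_norm A (u - A_proj A (span {u0}) u)))"
    using mult_right_mono[OF \<theta>, of "sqrt (lam * lamR i / lam1) * (\<eta>i * A_norm A (u - A_proj A (span {u0}) u))"]
      s \<eta>i A_norm_nonneg[OF spd] by simp
  finally show ?thesis by (simp only: mult.assoc)
qed

end
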